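(* Let $(M_n)_{n\in\mathbb{N}}$ be a martingale in $L^2(\Omega)$ with respect to $(\mathcal{F}_n)_{n\in\mathbb{N}}$, and let $M_{-1}=E[M_0]$. There exists a predictable process $(u_k)_{k\in\mathbb{N}}$ which is locally in $L^2(\Omega\times\mathbb{N})$ (i.e. $u(\cdot)\mathbf{1}_{[0,N]}(\cdot)\in L^2(\Omega\times\mathbb{N})$ for all $N>0$) such that $$M_n=M_{-1}+\sum_{k=0}^nu_kY_k,\qquad n\in\mathbb{N}.$$
   Context: $\mathbb{N}=\{0,1,2,\ldots\}$. Let $(p_k)_{k\in\mathbb{N}}$ be a deterministic sequence in $(0,1)$ and $q_k=1-p_k$. Let $\Omega=\{-1,1\}^{\mathbb{N}}$ with its product $\sigma$-algebra, let $X_k:\Omega\to\{-1,1\}$ be the canonical projections, and let $\mathbb{P}$ be the product probability measure under which the $X_k$ are independent with $\mathbb{P}(X_k=1)=p_k$, $\mathbb{P}(X_k=-1)=q_k$. Set $Y_k=\frac{q_k-p_k+X_k}{2\sqrt{p_kq_k}}$, $\mathcal{F}_n=\sigma(X_0,\ldots,X_n)$ for $n\ge0$, $\mathcal{F}_{-1}=\{\emptyset,\Omega\}$. A process $(u_k)_{k\in\mathbb{N}}$ is predictable if $u_k$ is $\mathcal{F}_{k-1}$-measurable for all $k\in\mathbb{N}$. *)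

theory Defs
  imports "HOL-Probability.Probability"
begin

definition sign_measure :: "real \<Rightarrow> real measure" where
  "sign_measure p = point_measure {-1, 1} (\<lambda>x. ennreal (if x = 1 then p else 1 - p))"

definition sign_space :: "(nat \<Rightarrow> real) \<Rightarrow> (nat \<Rightarrow> real) measure" where
  "sign_space p = (\<Pi>\<^sub>M k\<in>UNIV. sign_measure (p k))"

definition X :: "nat \<Rightarrow> (nat \<Rightarrow> real) \<Rightarrow> real" where
  "X k \<omega> = \<omega> k"

definition Y :: "(nat \<Rightarrow> real) \<Rightarrow> nat \<Rightarrow> (nat \<Rightarrow> real) \<Rightarrow> real" where
  "Y p k \<omega> = ((1 - p k) - p k + X k \<omega>) / (2 * sqrt (p k * (1 - p k)))"

(* The index is an integer so that the initial sigma-algebra, at time -1, is included;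
   it is generated by the empty family and hence trivial.  Only the space and the sets of
   the measure are relevant. *)
definition Filt :: "(nat \<Rightarrow> real) \<Rightarrow> int \<Rightarrow> (nat \<Rightarrow> real) measure" where
  "Filt p n = sigma (space (sign_space p))
     (\<Union>k\<in>{k. int k \<le> n}. {X k -` A \<inter> space (sign_space p) |A. A \<in> sets borel})"

definition square_integrable :: "'a measure \<Rightarrow> ('a \<Rightarrow> real) \<Rightarrow> bool" where
  "square_integrable M f \<longleftrightarrow> f \<in> borel_measurable M \<and> integrable M (\<lambda>x. (f x)\<^sup>2)"

definition martingale :: "'a measure \<Rightarrow> (nat \<Rightarrow> 'a measure) \<Rightarrow> (nat \<Rightarrow> 'a \<Rightarrow> real) \<Rightarrow> bool" where
  "martingale P G M \<longleftrightarrow>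
     (\<forall>n. M n \<in> borel_measurable (G n) \<and> integrable P (M n)) \<and>
     (\<forall>m n. m \<le> n \<longrightarrow> (AE \<omega> in P. real_cond_exp P (G m) (M n) \<omega> = M m \<omega>))"

definition predictable :: "(nat \<Rightarrow> real) \<Rightarrow> (nat \<Rightarrow> (nat \<Rightarrow> real) \<Rightarrow> real) \<Rightarrow> bool" where
  "predictable p u \<longleftrightarrow> (\<forall>k. u k \<in> borel_measurable (Filt p (int k - 1)))"

definition locally_L2 :: "'a measure \<Rightarrow> (nat \<Rightarrow> 'a \<Rightarrow> real) \<Rightarrow> bool" where
  "locally_L2 P u \<longleftrightarrow>
     (\<forall>N>0. square_integrable (P \<Otimes>\<^sub>M count_space UNIV)
        (\<lambda>(\<omega>, k). u k \<omega> * indicator {0..N} k))"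

end

theory Submission
  imports Defs
begin

text \<open>
  An \<open>\<F>\<^sub>n\<close>-measurable function depends on the signs up to time \<open>n\<close> only, and every cylinder
  fixing finitely many signs has positive probability.  Integrating the martingale over the cylinder
  of the first \<open>k\<close> signs of \<open>\<omega>\<close> therefore gives the pointwise identity
  \<open>M\<^sub>k\<^sub>-\<^sub>1(\<omega>) = p\<^sub>k M\<^sub>k(\<omega>\<^sup>+) + q\<^sub>k M\<^sub>k(\<omega>\<^sup>-)\<close>, where \<open>\<omega>\<^sup>+\<close> and \<open>\<omega>\<^sup>-\<close> have the \<open>k\<close>-th sign of \<open>\<omega>\<close> replaced
  by \<open>1\<close> and \<open>-1\<close>.  Since \<open>Y\<^sub>k\<close> takes the values \<open>\<surd>(q\<^sub>k/p\<^sub>k)\<close> and \<open>-\<surd>(p\<^sub>k/q\<^sub>k)\<close>, the increment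
  is \<open>u\<^sub>k Y\<^sub>k\<close> with \<open>u\<^sub>k(\<omega>) = \<surd>(p\<^sub>k q\<^sub>k) (M\<^sub>k(\<omega>\<^sup>+) - M\<^sub>k(\<omega>\<^sup>-))\<close>, which does not involve the \<open>k\<close>-th sign.
  It takes finitely many values, so it is bounded and local square integrability is immediate.
\<close>

section \<open>The sign space and its filtration\<close>

lemma space_sign_space: "space (sign_space p) = {\<omega>. \<forall>i. \<omega> i \<in> {-1, 1}}"
  by (auto simp: sign_space_def sign_measure_def space_PiM space_point_measure PiE_def Pi_def)

lemma prob_space_sign_measure:
  assumes "0 < p" "p < 1"
  shows "prob_space (sign_measure p)"
  using assms
  by (intro prob_spaceI)
     (simp add: sign_measure_def space_point_measure emeasure_point_measure_finite flip: ennreal_plus)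

lemma prob_space_sign_space:
  assumes "\<And>k. 0 < p k \<and> p k < 1"
  shows "prob_space (sign_space p)"
  unfolding sign_space_def using assms by (intro prob_space_PiM prob_space_sign_measure) auto

lemma X_measurable: "X k \<in> borel_measurable (sign_space p)"
proof -
  have "(\<lambda>\<omega>. \<omega> k) \<in> sign_space p \<rightarrow>\<^sub>M sign_measure (p k)"
    unfolding sign_space_def by (rule measurable_component_singleton) simp
  moreover have "(\<lambda>x. x) \<in> borel_measurable (sign_measure (p k))"
    by (simp add: sign_measure_def measurable_def space_point_measure sets_point_measure)
  ultimately have "(\<lambda>\<omega>. \<omega> k) \<in> borel_measurable (sign_space p)"
    by (rule measurable_compose)
  then show ?thesis by (simp add: X_def[abs_def])
qed

lemma space_Filt: "space (Filt p n) = space (sign_space p)"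
  by (auto simp: Filt_def intro!: space_measure_of)

lemma sets_Filt:
  "sets (Filt p n) = sigma_sets (space (sign_space p))
     (\<Union>k\<in>{k. int k \<le> n}. {X k -` A \<inter> space (sign_space p) |A. A \<in> sets borel})"
  by (auto simp: Filt_def intro!: sets_measure_of)

lemma subalgebra_Filt: "subalgebra (sign_space p) (Filt p n)"
  unfolding subalgebra_def
  by (auto simp: space_Filt sets_Filt intro!: sets.sigma_sets_subset measurable_sets[OF X_measurable])

lemma X_measurable_Filt: "int k \<le> n \<Longrightarrow> X k \<in> borel_measurable (Filt p n)"
  by (intro measurableI) (auto simp: space_Filt sets_Filt)

text \<open>The sets that do not separate \<open>\<omega>\<close> from \<open>\<omega>'\<close> are
  closed under complement and countable union and include the generators. So the level set of
  \<open>f\<close> at \<open>f \<omega>\<close> also contains \<open>\<omega>'\<close>.\<close>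

lemma Filt_measurable_cong:
  fixes f :: "(nat \<Rightarrow> real) \<Rightarrow> real"
  assumes f: "f \<in> borel_measurable (Filt p n)"
    and \<omega>: "\<omega> \<in> space (sign_space p)" and \<omega>': "\<omega>' \<in> space (sign_space p)"
    and eq: "\<And>i. int i \<le> n \<Longrightarrow> \<omega> i = \<omega>' i"
  shows "f \<omega> = f \<omega>'"
proof -
  have *: "\<omega> \<in> A \<longleftrightarrow> \<omega>' \<in> A" if "A \<in> sets (Filt p n)" for A
    using that unfolding sets_Filt
    by (induction rule: sigma_sets.induct) (use \<omega> \<omega>' eq in \<open>auto simp: X_def\<close>)
  have "f -` {f \<omega>} \<inter> space (Filt p n) \<in> sets (Filt p n)"
    using f by (rule measurable_sets) simp
  from *[OF this] show ?thesis using \<omega> \<omega>' by (auto simp: space_Filt)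
qed

lemma fun_upd_in_space:
  "\<omega> \<in> space (sign_space p) \<Longrightarrow> s \<in> {-1, 1} \<Longrightarrow> \<omega> (k := s) \<in> space (sign_space p)"
  by (auto simp: space_sign_space)

text \<open>Needed for predictability of the integrand: after overwriting sign \<open>k\<close>,
  coordinate \<open>k\<close> is constant, so a generator of time \<open>k\<close> pulls back to an
  event about earlier signs.\<close>

lemma fun_upd_measurable_Filt:
  assumes "s \<in> {-1, 1}"
  shows "(\<lambda>\<omega>. \<omega> (k := s)) \<in> Filt p (int k - 1) \<rightarrow>\<^sub>M Filt p (int k)"
  unfolding Filt_def[of p "int k"]
proof (rule measurable_measure_of)
  show "(\<lambda>\<omega>. \<omega> (k := s)) \<in> space (Filt p (int k - 1)) \<rightarrow> space (sign_space p)"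
    using assms by (auto simp: space_Filt fun_upd_in_space)
  fix B assume "B \<in> (\<Union>i\<in>{i. int i \<le> int k}. {X i -` A \<inter> space (sign_space p) |A. A \<in> sets borel})"
  then obtain i A where i: "i \<le> k" and A: "A \<in> sets borel" and B: "B = X i -` A \<inter> space (sign_space p)"
    by auto
  have *: "(\<lambda>\<omega>. \<omega> (k := s)) -` B \<inter> space (Filt p (int k - 1))
      = (\<lambda>\<omega>. X i (\<omega> (k := s))) -` A \<inter> space (Filt p (int k - 1))"
    using assms by (auto simp: B space_Filt fun_upd_in_space)
  have "(\<lambda>\<omega>. X i (\<omega> (k := s))) = (if i = k then (\<lambda>_. s) else X i)"
    by (auto simp: X_def)
  then have "(\<lambda>\<omega>. X i (\<omega> (k := s))) \<in> borel_measurable (Filt p (int k - 1))"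
    using i by (auto intro!: X_measurable_Filt)
  then show "(\<lambda>\<omega>. \<omega> (k := s)) -` B \<inter> space (Filt p (int k - 1)) \<in> sets (Filt p (int k - 1))"
    unfolding * using A by (rule measurable_sets)
qed auto

lemma Filt_measurable_bounded:
  fixes f :: "(nat \<Rightarrow> real) \<Rightarrow> real"
  assumes f: "f \<in> borel_measurable (Filt p n)"
  obtains B where "\<And>\<omega>. \<omega> \<in> space (sign_space p) \<Longrightarrow> \<bar>f \<omega>\<bar> \<le> B"
proof -
  \<comment> \<open>\<open>S\<close> records the positions of the sign 1. All signs after time
    \<open>n\<close> become -1, which cannot change the value of \<open>f\<close>; thus
    \<open>f\<close> factors through a finite power set.\<close>
  define g where "g S = f (\<lambda>i. if i \<in> S then 1 else -1)" for S :: "nat set"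
  have "f ` space (sign_space p) \<subseteq> g ` Pow {i. int i \<le> n}"
  proof (rule image_subsetI)
    fix \<omega> assume \<omega>: "\<omega> \<in> space (sign_space p)"
    have "f \<omega> = g {i. int i \<le> n \<and> \<omega> i = 1}"
      unfolding g_def
      by (rule Filt_measurable_cong[OF f \<omega>]) (use \<omega> in \<open>auto simp: space_sign_space\<close>)
    then show "f \<omega> \<in> g ` Pow {i. int i \<le> n}" by auto
  qed
  moreover have "finite {i. int i \<le> n}"
    by (rule finite_subset[of _ "{..nat n}"]) auto
  ultimately have "finite (f ` space (sign_space p))"
    by (meson finite_Pow_iff finite_imageI finite_subset)
  then have "bounded (f ` space (sign_space p))"
    by (rule finite_imp_bounded)
  then show ?thesis
    by (auto simp: bounded_iff intro: that)
qed

section \<open>Cylinders and averages over them\<close>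

text \<open>The strict bound makes this an event of time \<open>n - 1\<close>, and the whole space
  for \<open>n = 0\<close>.\<close>

definition cylinder :: "(nat \<Rightarrow> real) \<Rightarrow> nat \<Rightarrow> (nat \<Rightarrow> real) set" where
  "cylinder \<omega> n = {\<omega>'. (\<forall>i. \<omega>' i \<in> {-1, 1}) \<and> (\<forall>i<n. \<omega>' i = \<omega> i)}"

lemma cylinder_in_Filt: "cylinder \<omega> n \<in> sets (Filt p (int n - 1))"
proof -
  have "cylinder \<omega> n = {\<omega>'\<in>space (Filt p (int n - 1)). \<forall>i<n. X i \<omega>' = \<omega> i}"
    by (auto simp: cylinder_def space_Filt space_sign_space X_def)
  also have "\<dots> = {\<omega>'\<in>space (Filt p (int n - 1)). \<forall>i\<in>{..<n}. X i \<omega>' = \<omega> i}"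
    by auto
  also have "\<dots> \<in> sets (Filt p (int n - 1))"
  proof (rule sets.sets_Collect_finite_All)
    fix i assume "i \<in> {..<n}"
    then have [measurable]: "X i \<in> borel_measurable (Filt p (int n - 1))"
      by (intro X_measurable_Filt) auto
    show "{\<omega>'\<in>space (Filt p (int n - 1)). X i \<omega>' = \<omega> i} \<in> sets (Filt p (int n - 1))"
      by measurable
  qed simp
  finally show ?thesis .
qed

lemma cylinder_in_sign_space: "cylinder \<omega> n \<in> sets (sign_space p)"
  using cylinder_in_Filt[of \<omega> n p] subalgebra_Filt[of p] unfolding subalgebra_def by blast

lemma measure_cylinder:
  assumes p: "\<And>k. 0 < p k \<and> p k < 1" and \<omega>: "\<omega> \<in> space (sign_space p)"
  shows "measure (sign_space p) (cylinder \<omega> n) = (\<Prod>i<n. if \<omega> i = 1 then p i else 1 - p i)"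
proof -
  interpret product_prob_space "\<lambda>k. sign_measure (p k)" UNIV
    using p by (intro product_prob_spaceI prob_space_sign_measure) auto
  have "cylinder \<omega> n = prod_emb UNIV (\<lambda>k. sign_measure (p k)) {..<n} (\<Pi>\<^sub>E i\<in>{..<n}. {\<omega> i})"
    by (auto simp: cylinder_def prod_emb_def sign_measure_def space_point_measure PiE_iff)
  moreover have sets: "{\<omega> i} \<in> sets (sign_measure (p i))" for i
    using \<omega> by (auto simp: space_sign_space sign_measure_def sets_point_measure)
  ultimately have "measure (sign_space p) (cylinder \<omega> n) = (\<Prod>i<n. measure (sign_measure (p i)) {\<omega> i})"
    using sets unfolding sign_space_def by (simp add: measure_PiM_emb)
  also have "\<dots> = (\<Prod>i<n. if \<omega> i = 1 then p i else 1 - p i)"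
  proof (rule prod.cong)
    fix i
    have "\<omega> i = 1 \<or> \<omega> i = -1" using \<omega> by (auto simp: space_sign_space)
    then show "measure (sign_measure (p i)) {\<omega> i} = (if \<omega> i = 1 then p i else 1 - p i)"
      using p[of i] by (auto simp: sign_measure_def measure_def emeasure_point_measure_finite)
  qed simp
  finally show ?thesis .
qed

text \<open>The factor on the right is the conditional expectation of \<open>f\<close> given the first \<open>k\<close> signs.\<close>
lemma integral_cylinder:
  fixes f :: "(nat \<Rightarrow> real) \<Rightarrow> real"
  assumes p: "\<And>k. 0 < p k \<and> p k < 1" and \<omega>: "\<omega> \<in> space (sign_space p)"
    and f: "f \<in> borel_measurable (Filt p (int k))"
  shows "(\<integral>\<omega>'\<in>cylinder \<omega> k. f \<omega>' \<partial>sign_space p) =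
    measure (sign_space p) (cylinder \<omega> k) * (p k * f (\<omega> (k := 1)) + (1 - p k) * f (\<omega> (k := -1)))"
proof -
  interpret prob_space "sign_space p" using p by (rule prob_space_sign_space)
  let ?C = "\<lambda>s. cylinder (\<omega> (k := s)) (Suc k)"
  have mem: "\<omega>' \<in> ?C s \<longleftrightarrow> \<omega>' \<in> cylinder \<omega> k \<and> \<omega>' k = s" for s \<omega>'
    by (auto simp: cylinder_def All_less_Suc)
  \<comment> \<open>The next sign splits the cylinder into two halves, and on each half
    \<open>f\<close> is constant.\<close>
  have eq: "indicator (cylinder \<omega> k) \<omega>' *\<^sub>R f \<omega>'
      = f (\<omega> (k := 1)) * indicator (?C 1) \<omega>' + f (\<omega> (k := -1)) * indicator (?C (-1)) \<omega>'"
    if \<omega>': "\<omega>' \<in> space (sign_space p)" for \<omega>'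
  proof (cases "\<omega>' \<in> cylinder \<omega> k")
    case True
    then have "f \<omega>' = f (\<omega> (k := \<omega>' k))"
      using \<omega> \<omega>' by (intro Filt_measurable_cong[OF f] fun_upd_in_space)
        (auto simp: cylinder_def)
    moreover have "\<omega>' k = 1 \<or> \<omega>' k = -1"
      using \<omega>' by (auto simp: space_sign_space)
    ultimately show ?thesis
      using True by (auto simp: mem)
  qed (simp add: mem)
  have "(\<integral>\<omega>'\<in>cylinder \<omega> k. f \<omega>' \<partial>sign_space p) =
    (\<integral>\<omega>'. f (\<omega> (k := 1)) * indicator (?C 1) \<omega>' + f (\<omega> (k := -1)) * indicator (?C (-1)) \<omega>' \<partial>sign_space p)"
    unfolding set_lebesgue_integral_def by (intro Bochner_Integration.integral_cong eq) auto
  also have "\<dots> = f (\<omega> (k := 1)) * prob (?C 1) + f (\<omega> (k := -1)) * prob (?C (-1))"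
    by (subst Bochner_Integration.integral_add)
       (auto simp: cylinder_in_sign_space emeasure_eq_measure)
  \<comment> \<open>Each half carries one more factor, \<open>p k\<close> or \<open>1 - p k\<close>;
    the earlier factors are untouched by the update.\<close>
  also have "\<dots> = prob (cylinder \<omega> k) * (p k * f (\<omega> (k := 1)) + (1 - p k) * f (\<omega> (k := -1)))"
    using \<omega> by (simp add: measure_cylinder[OF p] fun_upd_in_space algebra_simps)
  finally show ?thesis .
qed

text \<open>The martingale property holds only almost everywhere. Both sides are integrated over a
  cylinder of positive probability, and cancelling that probability gives equality at every
  \<open>\<omega>\<close>.\<close>

lemma martingale_average:
  assumes p: "\<And>k. 0 < p k \<and> p k < 1"
    and M: "martingale (sign_space p) (\<lambda>n. Filt p (int n)) M"
    and \<omega>: "\<omega> \<in> space (sign_space p)"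
  shows "p k * M k (\<omega> (k := 1)) + (1 - p k) * M k (\<omega> (k := -1)) =
    (case k of 0 \<Rightarrow> (\<integral>\<omega>'. M 0 \<omega>' \<partial>sign_space p) | Suc j \<Rightarrow> M j \<omega>)"
    (is "?avg = ?prev")
proof -
  interpret prob_space "sign_space p" using p by (rule prob_space_sign_space)
  let ?C = "cylinder \<omega> k"
  have meas: "M n \<in> borel_measurable (Filt p (int n))" and int: "integrable (sign_space p) (M n)" for n
    using M by (auto simp: martingale_def)
  have "(\<integral>\<omega>'\<in>?C. M k \<omega>' \<partial>sign_space p) = prob ?C * ?prev"
  proof (cases k)
    case 0
    then have "?C = space (sign_space p)" by (auto simp: cylinder_def space_sign_space)
    then show ?thesis
      using 0 prob_space by (simp add: set_integral_space[OF int])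
  next
    case (Suc j)
    interpret finite_measure_subalgebra "sign_space p" "Filt p (int j)"
      by unfold_locales (rule subalgebra_Filt)
    have C: "?C \<in> sets (Filt p (int j))" using cylinder_in_Filt[of \<omega> k p] Suc by simp
    have "(\<integral>\<omega>'\<in>?C. M k \<omega>' \<partial>sign_space p)
        = (\<integral>\<omega>'\<in>?C. real_cond_exp (sign_space p) (Filt p (int j)) (M k) \<omega>' \<partial>sign_space p)"
      by (rule real_cond_exp_intA[OF int C])
    also have "\<dots> = (\<integral>\<omega>'\<in>?C. M j \<omega>' \<partial>sign_space p)"
    proof -
      have "AE \<omega>' in sign_space p. real_cond_exp (sign_space p) (Filt p (int j)) (M k) \<omega>' = M j \<omega>'"
        using M Suc by (auto simp: martingale_def)
      then show ?thesis
        using int[of j] by (intro set_lebesgue_integral_cong_AE) (auto simp: cylinder_in_sign_space)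
    qed
    \<comment> \<open>The cylinder fixes exactly the signs up to time \<open>j = k - 1\<close>, so
      \<open>M j\<close> is constant on it.\<close>
    also have "\<dots> = (\<integral>\<omega>'\<in>?C. M j \<omega> \<partial>sign_space p)"
      using \<omega> Suc
      by (intro set_lebesgue_integral_cong cylinder_in_sign_space)
         (auto intro!: Filt_measurable_cong[OF meas] simp: cylinder_def space_sign_space)
    also have "\<dots> = prob ?C * M j \<omega>"
      by (simp add: set_lebesgue_integral_def cylinder_in_sign_space)
    finally show ?thesis using Suc by simp
  qed
  moreover have "prob ?C > 0"
    using p \<omega> by (auto simp: measure_cylinder intro!: prod_pos)
  ultimately show ?thesis
    using integral_cylinder[OF p \<omega> meas, of k] by simp
qed

section \<open>The representation and its square integrability\<close>

lemma sign_increment: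
  fixes a b p x :: real
  assumes "0 < p" "p < 1" "x \<in> {-1, 1}"
  shows "(if x = 1 then a else b) - (p * a + (1 - p) * b) =
    (a - b) * sqrt (p * (1 - p)) * (((1 - p) - p + x) / (2 * sqrt (p * (1 - p))))"
  using assms by (auto simp: field_simps)

text \<open>The truncated process vanishes off a set of finite measure. Only finitely many times
  remain, so bounds depending on \<open>k\<close> suffice.\<close>

lemma locally_L2_of_bounded:
  assumes "prob_space P"
    and meas: "\<And>k. u k \<in> borel_measurable P"
    and bdd: "\<And>k. \<exists>B. \<forall>\<omega>\<in>space P. \<bar>u k \<omega>\<bar> \<le> B"
  shows "locally_L2 P u"
  unfolding locally_L2_def square_integrable_def
proof (intro allI impI conjI)
  fix N :: nat
  interpret prob_space P by fact
  interpret C: sigma_finite_measure "count_space (UNIV :: nat set)"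
    by (rule sigma_finite_measure_count_space)
  let ?Q = "P \<Otimes>\<^sub>M count_space (UNIV :: nat set)"
  let ?f = "\<lambda>(\<omega>, k). u k \<omega> * indicator {0..N} k"
  show f: "?f \<in> borel_measurable ?Q"
    unfolding case_prod_beta
    by (rule measurable_compose_countable'[where f = "\<lambda>k x. u k (fst x) * indicator {0..N} k" and I = UNIV])
       (use meas in \<open>auto intro!: borel_measurable_times\<close>)
  from bdd obtain B where B: "\<And>k \<omega>. \<omega> \<in> space P \<Longrightarrow> \<bar>u k \<omega>\<bar> \<le> B k" by metis
  \<comment> \<open>Summing the squared bounds gives one bound valid for all
    \<open>k \<le> N\<close>.\<close>
  let ?b = "\<Sum>k\<le>N. (B k)\<^sup>2"
  show "integrable ?Q (\<lambda>x. (?f x)\<^sup>2)"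
  proof (rule integrableI_bounded_set[where A = "space P \<times> {0..N}" and B = ?b])
    show "space P \<times> {0..N} \<in> sets ?Q" by auto
    show "(\<lambda>x. (?f x)\<^sup>2) \<in> borel_measurable ?Q" using f by measurable
    have "emeasure ?Q (space P \<times> {0..N}) = emeasure P (space P) * emeasure (count_space UNIV) {0..N}"
      by (rule C.emeasure_pair_measure_Times) auto
    then show "emeasure ?Q (space P \<times> {0..N}) < \<infinity>"
      by (simp add: emeasure_space_1 emeasure_count_space ennreal_mult_less_top of_nat_less_top)
    have "(u k \<omega>)\<^sup>2 \<le> ?b" if "\<omega> \<in> space P" "k \<le> N" for \<omega> k
    proof -
      have "(u k \<omega>)\<^sup>2 \<le> (B k)\<^sup>2"
        using B[OF that(1)] by (metis abs_ge_zero power2_abs power_mono)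
      also have "\<dots> \<le> ?b"
        using that by (intro member_le_sum) auto
      finally show ?thesis .
    qed
    then show "AE x in ?Q. x \<in> space P \<times> {0..N} \<longrightarrow> norm ((?f x)\<^sup>2) \<le> ?b"
      by auto
    show "AE x in ?Q. x \<notin> space P \<times> {0..N} \<longrightarrow> (?f x)\<^sup>2 = 0"
      by (intro AE_I2) (auto simp: space_pair_measure indicator_def)
  qed
qed

theorem proposition8p9:
  fixes p :: "nat \<Rightarrow> real"
    and M :: "nat \<Rightarrow> (nat \<Rightarrow> real) \<Rightarrow> real"
  assumes "\<And>k. 0 < p k \<and> p k < 1"
    and "martingale (sign_space p) (\<lambda>n. Filt p (int n)) M"
    and "\<And>n. square_integrable (sign_space p) (M n)"
  shows "\<exists>u. predictable p u \<and> locally_L2 (sign_space p) u \<and>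
    (\<forall>n. \<forall>\<omega>\<in>space (sign_space p).
       M n \<omega> = (\<integral>\<omega>'. M 0 \<omega>' \<partial>sign_space p) + (\<Sum>k=0..n. u k \<omega> * Y p k \<omega>))"
proof (intro exI conjI allI ballI)
  note p = assms(1)
  \<comment> \<open>The two values of \<open>Y p k\<close> differ by
    \<open>1 / sqrt (p k * (1 - p k))\<close>, so \<open>u k\<close> is the jump of
    \<open>M k\<close> divided by the jump of \<open>Y p k\<close>.\<close>
  define u where
    "u k \<omega> = (M k (\<omega> (k := 1)) - M k (\<omega> (k := -1))) * sqrt (p k * (1 - p k))" for k \<omega>
  have meas: "M n \<in> borel_measurable (Filt p (int n))" for n
    using assms(2) by (auto simp: martingale_def)
  have u_meas: "u k \<in> borel_measurable (Filt p (int k - 1))" for k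
    unfolding u_def
    by (intro borel_measurable_times borel_measurable_diff borel_measurable_const
        measurable_compose[OF fun_upd_measurable_Filt meas]) auto
  then show "predictable p u" by (simp add: predictable_def)
  show "locally_L2 (sign_space p) u"
  proof (rule locally_L2_of_bounded)
    show "prob_space (sign_space p)" using p by (rule prob_space_sign_space)
    show "u k \<in> borel_measurable (sign_space p)" for k
      using u_meas by (rule measurable_from_subalg[OF subalgebra_Filt])
    show "\<exists>B. \<forall>\<omega>\<in>space (sign_space p). \<bar>u k \<omega>\<bar> \<le> B" for k
      by (rule Filt_measurable_bounded[OF u_meas]) blast
  qed
  fix n \<omega> assume \<omega>: "\<omega> \<in> space (sign_space p)"
  have increment: "M k \<omega> = (case k of 0 \<Rightarrow> (\<integral>\<omega>'. M 0 \<omega>' \<partial>sign_space p) | Suc j \<Rightarrow> M j \<omega>) + u k \<omega> * Y p k \<omega>" for k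
  proof -
    have \<omega>k: "\<omega> k \<in> {-1, 1}" using \<omega> by (auto simp: space_sign_space)
    then have "M k \<omega> = (if \<omega> k = 1 then M k (\<omega> (k := 1)) else M k (\<omega> (k := -1)))"
      by (auto simp: fun_upd_idem)
    moreover have "u k \<omega> * Y p k \<omega> = (if \<omega> k = 1 then M k (\<omega> (k := 1)) else M k (\<omega> (k := -1)))
        - (p k * M k (\<omega> (k := 1)) + (1 - p k) * M k (\<omega> (k := -1)))"
      unfolding u_def Y_def X_def using p[of k] \<omega>k by (intro sign_increment[symmetric]) auto
    ultimately show ?thesis
      unfolding martingale_average[OF p assms(2) \<omega>] by simp
  qed
  \<comment> \<open>The increments telescope, starting from the expectation of
    \<open>M 0\<close>.\<close>
  show "M n \<omega> = (\<integral>\<omega>'. M 0 \<omega>' \<partial>sign_space p) + (\<Sum>k=0..n. u k \<omega> * Y p k \<omega>)"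
  proof (induction n)
    case 0
    show ?case using increment[of 0] by simp
  next
    case (Suc n)
    then show ?case using increment[of "Suc n"] by simp
  qed
qed

end
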